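(* Let $X$ be a Banach space admitting an equivalent norm with property $(\beta)$. Then $\mathrm{c}_0$ is not a coarse subquotient of $X$ via a coarse quotient map that is Lipschitz for large distances; that is, there do not exist a subset $Z\subset X$ and a coarse quotient map $f\colon Z\to\mathrm{c}_0$ that is Lipschitz for large distances.
   Context: All metric spaces are nonempty and $B_M(x,r)$ denotes the closed ball of a metric space $M$. For a subset $A$ of a metric space $N$ and $K\ge0$, $A^K:=\{y\in N: d_N(y,z)\le K\text{ for some }z\in A\}$. A map $f\colon M\to N$ between metric spaces is coarsely continuous if $\omega_f(t):=\sup\{d_N(f(x),f(y)): d_M(x,y)\le t\}<\infty$ for all $t>0$. It is co-coarsely continuous with constant $K\in[0,\infty)$ if for every $\varepsilon>0$ there is $\delta=\delta(\varepsilon)>0$ such that for every $x\in M$, $B_N(f(x),\varepsilon)\subset f(B_M(x,\delta))^K$. $f$ is a coarse quotient map (with constant $K$) if it is coarsely continuous and co-coarsely continuous (with constant $K$, for some $K\in[0,\infty)$). $N$ is a coarse subquotient of $M$ if there is a coarse quotient map from a subset of $M$ to $N$. A map $f\colon M\to N$ is Lipschitz for large distances if for every $s\in(0,\infty)$ there is $L\in(0,\infty)$ (depending on $s$) such that $f(B_M(x,r))\subset B_N(f(x),Lr)$ for all $r\ge s$ and $x\in M$. A Banach space $X$ with closed unit ball $B_X$ has property $(\beta)$ if for any $\varepsilon>0$ there is $\delta(\varepsilon)\in(0,1)$ such that for every $x\in B_X$ and every sequence $(y_i)_{i=1}^\infty\subset B_X$ with $\inf\{\|y_n-y_m\|: n\ne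 m\}\ge\varepsilon$ there is $i_0\in\mathbb N$ with $\left\|\frac{x-y_{i_0}}2\right\|\le 1-\delta(\varepsilon)$. *)

theory Defs
  imports "HOL-Analysis.Analysis"
begin

text \<open>A metric space is represented by a subset M of a metric type, with the induced distance.
  Its closed balls are the sets \<open>cball x r \<inter> M\<close>.\<close>

definition enlargement :: "'b::metric_space set \<Rightarrow> 'b set \<Rightarrow> real \<Rightarrow> 'b set" where
  "enlargement N A K = {y \<in> N. \<exists>z\<in>A. dist y z \<le> K}"

definition expansion_modulus ::
  "'a::metric_space set \<Rightarrow> ('a \<Rightarrow> 'b::metric_space) \<Rightarrow> real \<Rightarrow> ereal" where
  "expansion_modulus M f t =
     Sup {ereal (dist (f x) (f y)) | x y. x \<in> M \<and> y \<in> M \<and> dist x y \<le> t}"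

definition coarsely_continuous ::
  "'a::metric_space set \<Rightarrow> ('a \<Rightarrow> 'b::metric_space) \<Rightarrow> bool" where
  "coarsely_continuous M f \<longleftrightarrow> (\<forall>t>0. expansion_modulus M f t < \<infinity>)"

definition co_coarsely_continuous ::
  "real \<Rightarrow> 'a::metric_space set \<Rightarrow> 'b::metric_space set \<Rightarrow> ('a \<Rightarrow> 'b) \<Rightarrow> bool" where
  "co_coarsely_continuous K M N f \<longleftrightarrow>
     (\<forall>\<epsilon>>0. \<exists>\<delta>>0. \<forall>x\<in>M.
        cball (f x) \<epsilon> \<inter> N \<subseteq> enlargement N (f ` (cball x \<delta> \<inter> M)) K)"

definition coarse_quotient_map ::
  "'a::metric_space set \<Rightarrow> 'b::metric_space set \<Rightarrow> ('a \<Rightarrow> 'b) \<Rightarrow> bool" where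
  "coarse_quotient_map M N f \<longleftrightarrow>
     f \<in> M \<rightarrow> N \<and> coarsely_continuous M f \<and> (\<exists>K\<ge>0. co_coarsely_continuous K M N f)"

definition lipschitz_for_large_distances ::
  "'a::metric_space set \<Rightarrow> 'b::metric_space set \<Rightarrow> ('a \<Rightarrow> 'b) \<Rightarrow> bool" where
  "lipschitz_for_large_distances M N f \<longleftrightarrow>
     (\<forall>s>0. \<exists>L>0. \<forall>r\<ge>s. \<forall>x\<in>M. f ` (cball x r \<inter> M) \<subseteq> cball (f x) (L * r) \<inter> N)"

definition equivalent_norm :: "('a::real_normed_vector \<Rightarrow> real) \<Rightarrow> bool" where
  "equivalent_norm \<nu> \<longleftrightarrow>
     (\<forall>x. 0 \<le> \<nu> x) \<and> (\<forall>x. \<nu> x = 0 \<longleftrightarrow> x = 0) \<and>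
     (\<forall>a x. \<nu> (a *\<^sub>R x) = \<bar>a\<bar> * \<nu> x) \<and> (\<forall>x y. \<nu> (x + y) \<le> \<nu> x + \<nu> y) \<and>
     (\<exists>c>0. \<exists>C>0. \<forall>x. c * norm x \<le> \<nu> x \<and> \<nu> x \<le> C * norm x)"

text \<open>Property (beta) of the underlying space with respect to a norm \<open>\<nu>\<close> on it.\<close>

definition property_beta :: "('a::real_vector \<Rightarrow> real) \<Rightarrow> bool" where
  "property_beta \<nu> \<longleftrightarrow>
     (\<forall>\<epsilon>>0. \<exists>\<delta>\<in>{0<..<1}. \<forall>x (y :: nat \<Rightarrow> 'a).
        \<nu> x \<le> 1 \<and> (\<forall>i. \<nu> (y i) \<le> 1) \<and>
        Inf {\<nu> (y n - y m) | n m. n \<noteq> m} \<ge> \<epsilon> \<longrightarrow>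
        (\<exists>i. \<nu> ((x - y i) /\<^sub>R 2) \<le> 1 - \<delta>))"

text \<open>The distance on bounded (continuous) functions from the discrete space \<open>nat\<close> is the
  supremum distance, so this is \<open>c\<^sub>0\<close> as a closed subspace of the space of bounded sequences.\<close>

definition c0 :: "(nat \<Rightarrow>\<^sub>C real) set" where
  "c0 = {u. apply_bcontfun u \<longlonglongrightarrow> 0}"

end

theory Submission
  imports Defs
begin

text \<open>
  Let \<open>f\<close> be a coarse quotient map from \<open>Z\<close> to \<open>c\<^sub>0\<close> with constant \<open>K\<close>, Lipschitz for large
  distances, and let \<open>\<nu>\<close> be a norm with property (beta). Every \<open>y \<in> c\<^sub>0\<close> at distance at most \<open>s\<close>
  from \<open>f x\<close> is, up to the error \<open>K\<close>, the image of a point within some \<open>\<nu>\<close>-distance \<open>\<rho>\<close> of \<open>x\<close>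
  (predicate \<open>lifts\<close>). Call \<open>a\<close> a lifting slope if \<open>\<rho> = a s\<close> works for all large \<open>s\<close>. The proof
  plays three facts about lifting slopes against each other.

  A lifting slope exists (\<open>co_coarsely_continuous_lifting_slope\<close>): \<open>c\<^sub>0\<close> is geodesic, so co-coarse
  continuity at one fixed scale can be iterated along a segment.

  Lifting slopes are bounded away from \<open>0\<close> (\<open>lifting_slope_lower_bound\<close>), because \<open>f\<close> is Lipschitz
  at large scales and so cannot reach distance \<open>s\<close> without moving by a multiple of \<open>s\<close>.

  Any positive lifting slope below a fixed bound can be multiplied by a fixed factor \<open>\<theta> < 1\<close>
  (\<open>lifting_slope_shrink\<close>). To reach \<open>f x + u\<close> from \<open>f x\<close>, where \<open>norm u \<le> r\<close>, lift the paths
  \<open>f x \<rightarrow> f x + u/3 \<rightarrow> f x + p\<^sub>n \<rightarrow> f x + u\<close>, where \<open>p\<^sub>n\<close> is \<open>2u/3\<close> plus \<open>r/3\<close> times a far out unit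
  vector. In the supremum norm each leg still has length about \<open>r/3\<close>, although the \<open>p\<^sub>n\<close> are
  \<open>r/3\<close>-separated. If \<open>z\<close> and \<open>w\<^sub>n\<close> are the lifts of \<open>f x + u/3\<close> and \<open>f x + p\<^sub>n\<close>, then \<open>x\<close> and all
  the \<open>w\<^sub>n\<close> lie in a ball of radius about \<open>a r/3\<close> around \<open>z\<close>, and the \<open>w\<^sub>n\<close> are separated by a
  multiple of \<open>r\<close>, again by the Lipschitz condition. Property (beta) makes some \<open>w\<^sub>n\<close> strictly
  closer to \<open>x\<close> than twice that radius, and the third leg can be lifted from that \<open>w\<^sub>n\<close>. The third
  leg is essential: the lifts of its end point from the various \<open>w\<^sub>n\<close> differ, so the gain has to
  be made before the paths come together again.

  The separation of the \<open>w\<^sub>n\<close> relative to the radius only depends on an upper bound for \<open>a\<close>, so the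
  same \<open>\<theta>\<close> serves at every step of the iteration, which contradicts the lower bound.
\<close>

section \<open>Equivalent norms and property (beta)\<close>

lemma equivalent_norm_minus_commute:
  assumes "equivalent_norm \<nu>"
  shows "\<nu> (x - y) = \<nu> (y - x)"
proof -
  have "\<nu> ((-1) *\<^sub>R (y - x)) = \<bar>-1\<bar> * \<nu> (y - x)"
    using assms unfolding equivalent_norm_def by blast
  thus ?thesis by simp
qed

lemma equivalent_norm_diff_triangle:
  assumes "equivalent_norm \<nu>"
  shows "\<nu> (x - z) \<le> \<nu> (x - y) + \<nu> (y - z)"
proof -
  have "\<nu> ((x - y) + (y - z)) \<le> \<nu> (x - y) + \<nu> (y - z)"
    using assms unfolding equivalent_norm_def by blast
  thus ?thesis by simp
qed

text \<open>Property (beta), rescaled from the unit ball to the ball of radius \<open>\<rho>\<close> around \<open>z\<close>, read as a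
  statement about a fork with root \<open>x\<close>, branching point \<open>z\<close> and tips \<open>w i\<close>: if its arms have length
  at most \<open>\<rho>\<close>, then some tip is closer to the root than the triangle inequality guarantees.\<close>

lemma property_beta_fork:
  assumes eq: "equivalent_norm \<nu>" and beta: "property_beta \<nu>" and "\<epsilon> > 0"
  obtains \<delta> where "0 < \<delta>" "\<delta> < 1"
    "\<And>\<rho> x z w. \<lbrakk>\<rho> > 0; \<nu> (x - z) \<le> \<rho>; \<And>i::nat. \<nu> (w i - z) \<le> \<rho>;
        \<And>i j. i \<noteq> j \<Longrightarrow> \<nu> (w i - w j) \<ge> \<epsilon> * \<rho>\<rbrakk> \<Longrightarrow> \<exists>i. \<nu> (x - w i) \<le> 2 * (1 - \<delta>) * \<rho>"
proof -
  have scale: "\<nu> (a *\<^sub>R v) = \<bar>a\<bar> * \<nu> v" for a v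
    using eq unfolding equivalent_norm_def by blast
  obtain \<delta> where \<delta>: "\<delta> \<in> {0<..<1}" and main: "\<And>x (y :: nat \<Rightarrow> 'a).
        \<nu> x \<le> 1 \<Longrightarrow> (\<And>i. \<nu> (y i) \<le> 1) \<Longrightarrow>
        Inf {\<nu> (y n - y m) | n m. n \<noteq> m} \<ge> \<epsilon> \<Longrightarrow>
        \<exists>i. \<nu> ((x - y i) /\<^sub>R 2) \<le> 1 - \<delta>"
    using beta \<open>\<epsilon> > 0\<close> unfolding property_beta_def by meson
  show ?thesis
  proof (rule that)
    show "0 < \<delta>" "\<delta> < 1" using \<delta> by auto
    fix \<rho> x z and w :: "nat \<Rightarrow> 'a"
    assume \<rho>: "\<rho> > 0" and x: "\<nu> (x - z) \<le> \<rho>" and w: "\<And>i. \<nu> (w i - z) \<le> \<rho>"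
      and sep: "\<And>i j. i \<noteq> j \<Longrightarrow> \<nu> (w i - w j) \<ge> \<epsilon> * \<rho>"
    let ?x = "(x - z) /\<^sub>R \<rho>" and ?y = "\<lambda>i. (w i - z) /\<^sub>R \<rho>"
    have d: "?y n - ?y m = (w n - w m) /\<^sub>R \<rho>" for n m
      by (simp flip: scaleR_diff_right)
    have "\<exists>i. \<nu> ((?x - ?y i) /\<^sub>R 2) \<le> 1 - \<delta>"
    proof (rule main)
      show "\<nu> ?x \<le> 1" using x \<rho> unfolding scale by (simp add: field_simps)
      show "\<nu> (?y i) \<le> 1" for i using w[of i] \<rho> unfolding scale by (simp add: field_simps)
      show "Inf {\<nu> (?y n - ?y m) | n m. n \<noteq> m} \<ge> \<epsilon>"
      proof (rule cInf_greatest)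
        show "{\<nu> (?y n - ?y m) | n m. n \<noteq> m} \<noteq> {}"
          using zero_neq_one[where 'a=nat] by blast
        show "\<epsilon> \<le> t" if t: "t \<in> {\<nu> (?y n - ?y m) | n m. n \<noteq> m}" for t
        proof -
          obtain n m where "n \<noteq> m" and "t = \<nu> (?y n - ?y m)" using t by blast
          hence "t = \<nu> (w n - w m) / \<rho>" using \<rho> unfolding d scale by (simp add: field_simps)
          thus ?thesis using sep[OF \<open>n \<noteq> m\<close>] \<rho> by (simp add: pos_le_divide_eq)
        qed
      qed
    qed
    then obtain i where i: "\<nu> ((?x - ?y i) /\<^sub>R 2) \<le> 1 - \<delta>" by blast
    have "?x - ?y i = (x - w i) /\<^sub>R \<rho>" by (simp flip: scaleR_diff_right)
    hence "\<nu> ((?x - ?y i) /\<^sub>R 2) = \<nu> (x - w i) / (2 * \<rho>)"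
      using \<rho> by (simp only: scale) (simp add: field_simps)
    hence "\<nu> (x - w i) / (2 * \<rho>) \<le> 1 - \<delta>" using i by linarith
    thus "\<exists>i. \<nu> (x - w i) \<le> 2 * (1 - \<delta>) * \<rho>" using \<rho> by (auto simp: field_simps)
  qed
qed

section \<open>Forks in the space of null sequences\<close>

lemma c0_add: "u \<in> c0 \<Longrightarrow> v \<in> c0 \<Longrightarrow> u + v \<in> c0"
  unfolding c0_def using tendsto_add[of _ 0 sequentially _ 0]
  by (simp add: plus_bcontfun.rep_eq)

lemma c0_scaleR: "u \<in> c0 \<Longrightarrow> a *\<^sub>R u \<in> c0"
  unfolding c0_def using tendsto_mult_right_zero[of _ sequentially a]
  by (simp add: scaleR_bcontfun.rep_eq)

lemma c0_diff: "u \<in> c0 \<Longrightarrow> v \<in> c0 \<Longrightarrow> u - v \<in> c0"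
  using c0_add[of u "(-1) *\<^sub>R v"] c0_scaleR[of v "-1"] by simp

definition unit_seq :: "nat \<Rightarrow> (nat \<Rightarrow>\<^sub>C real)" where
  "unit_seq n = Bcontfun (\<lambda>k. if k = n then 1 else 0)"

lemma apply_unit_seq: "apply_bcontfun (unit_seq n) k = (if k = n then 1 else 0)"
proof -
  have "(\<lambda>k. if k = n then 1 else 0 :: real) \<in> bcontfun"
    by (rule bcontfun_normI[where b = 1]) (auto intro: continuous_on_discrete)
  thus ?thesis unfolding unit_seq_def by (simp add: Bcontfun_inverse)
qed

lemma unit_seq_in_c0: "unit_seq n \<in> c0"
proof -
  have "\<forall>\<^sub>F k in sequentially. apply_bcontfun (unit_seq n) k = 0"
    using eventually_gt_at_top[of n] by eventually_elim (simp add: apply_unit_seq)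
  thus ?thesis unfolding c0_def by (simp add: tendsto_eventually)
qed

text \<open>The witnesses are \<open>2u/3\<close> plus \<open>r/3\<close> times a unit vector placed beyond the essential support
  of \<open>u\<close>. There the entries of \<open>u/3\<close> are at most \<open>1\<close>, so the bump leaves the distances
  to \<open>u/3\<close> and to \<open>u\<close> near \<open>r/3\<close> while it separates the witnesses.\<close>

lemma c0_fork:
  assumes u: "u \<in> c0" and norm_u: "norm u \<le> r"
  obtains p :: "nat \<Rightarrow> (nat \<Rightarrow>\<^sub>C real)" where
    "\<And>n. p n \<in> c0" "\<And>n. norm (p n - (1/3) *\<^sub>R u) \<le> r / 3 + 1"
    "\<And>n. norm (u - p n) \<le> r / 3 + 1" "\<And>n k. n \<noteq> k \<Longrightarrow> norm (p n - p k) \<ge> r / 3"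
proof -
  \<comment> \<open>The bound \<open>3\<close> makes the entries of \<open>u/3\<close> at most \<open>1\<close>, the slack in the conclusion.\<close>
  have "\<forall>\<^sub>F k in sequentially. norm (apply_bcontfun u k - 0) < 3"
    using u tendstoD[of "apply_bcontfun u" 0 sequentially 3] unfolding c0_def by (simp add: dist_norm)
  then obtain N where N: "\<And>k. k \<ge> N \<Longrightarrow> \<bar>apply_bcontfun u k\<bar> < 3"
    by (auto simp: eventually_sequentially)
  have r: "\<bar>apply_bcontfun u k\<bar> \<le> r" for k
    using norm_bounded[of u k] norm_u by simp
  have r0: "0 \<le> r" using r[of 0] by linarith
  define p where "p n = (2/3) *\<^sub>R u + (r/3) *\<^sub>R unit_seq (N + n)" for n
  show ?thesis
  proof (rule that)
    show "p n \<in> c0" for n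
      unfolding p_def by (intro c0_add c0_scaleR u unit_seq_in_c0)
    show "norm (p n - (1/3) *\<^sub>R u) \<le> r / 3 + 1" for n
    proof (rule norm_bound)
      show "norm (apply_bcontfun (p n - (1/3) *\<^sub>R u) k) \<le> r / 3 + 1" for k
        using r[of k] N[of k] r0 unfolding p_def
        by (auto simp: plus_bcontfun.rep_eq minus_bcontfun.rep_eq scaleR_bcontfun.rep_eq
            apply_unit_seq abs_if split: if_splits)
    qed
    show "norm (u - p n) \<le> r / 3 + 1" for n
    proof (rule norm_bound)
      show "norm (apply_bcontfun (u - p n) k) \<le> r / 3 + 1" for k
        using r[of k] N[of k] r0 unfolding p_def
        by (auto simp: plus_bcontfun.rep_eq minus_bcontfun.rep_eq scaleR_bcontfun.rep_eq
            apply_unit_seq abs_if split: if_splits)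
    qed
    show "norm (p n - p k) \<ge> r / 3" if "n \<noteq> k" for n k
      using norm_bounded[of "p n - p k" "N + n"] that r0 unfolding p_def
      by (simp add: plus_bcontfun.rep_eq minus_bcontfun.rep_eq scaleR_bcontfun.rep_eq
            apply_unit_seq)
  qed
qed

section \<open>Lifting at large scales\<close>

text \<open>The quantitative form of co-coarse continuity at a single scale \<open>s\<close>, with the displacement
  in the domain measured by the norm \<open>\<nu>\<close> that has property (beta).\<close>

definition lifts ::
  "('a::real_vector \<Rightarrow> real) \<Rightarrow> 'a set \<Rightarrow> 'b::metric_space set \<Rightarrow> ('a \<Rightarrow> 'b) \<Rightarrow> real \<Rightarrow> real \<Rightarrow> real \<Rightarrow> bool"
  where "lifts \<nu> Z N f K \<rho> s \<longleftrightarrow>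
    (\<forall>x\<in>Z. \<forall>y\<in>N. dist (f x) y \<le> s \<longrightarrow> (\<exists>z\<in>Z. \<nu> (z - x) \<le> \<rho> \<and> dist (f z) y \<le> K))"

text \<open>The infimum of all such \<open>a\<close> is the inverse of the asymptotic co-Lipschitz constant of \<open>f\<close>
  (for \<open>\<nu>\<close>, and up to the error \<open>K\<close>). The
  scales are only required to be large so that additive errors such as \<open>K\<close> can be absorbed.\<close>

definition lifting_slope ::
  "('a::real_vector \<Rightarrow> real) \<Rightarrow> 'a set \<Rightarrow> 'b::metric_space set \<Rightarrow> ('a \<Rightarrow> 'b) \<Rightarrow> real \<Rightarrow> real \<Rightarrow> bool"
  where "lifting_slope \<nu> Z N f K a \<longleftrightarrow> (\<forall>\<^sub>F s in at_top. lifts \<nu> Z N f K (a * s) s)"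

lemma liftsE:
  assumes "lifts \<nu> Z N f K \<rho> s" "x \<in> Z" "y \<in> N" "dist (f x) y \<le> s"
  obtains z where "z \<in> Z" "\<nu> (z - x) \<le> \<rho>" "dist (f z) y \<le> K"
  using assms unfolding lifts_def by blast

lemma lifts_mono:
  "lifts \<nu> Z N f K \<rho> s \<Longrightarrow> \<rho> \<le> \<rho>' \<Longrightarrow> s' \<le> s \<Longrightarrow> lifts \<nu> Z N f K \<rho>' s'"
  unfolding lifts_def by (meson order_trans)

lemma c0_segment_point:
  assumes "u \<in> c0" "v \<in> c0" "dist u v \<le> s + t" "s \<ge> 0" "t \<ge> 0"
  obtains m where "m \<in> c0" "dist u m \<le> s" "dist m v \<le> t"
proof (cases "s + t = 0")
  case True
  thus ?thesis using assms that[of u] by simp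
next
  case False
  hence pos: "s + t > 0" using assms by linarith
  let ?m = "u + (s / (s + t)) *\<^sub>R (v - u)"
  show ?thesis
  proof (rule that)
    show "?m \<in> c0" by (intro c0_add c0_scaleR c0_diff assms)
    have "dist u ?m = s / (s + t) * dist u v"
      using assms by (simp add: dist_norm norm_minus_commute)
    also have "\<dots> \<le> s / (s + t) * (s + t)"
      using assms by (intro mult_left_mono) auto
    finally show "dist u ?m \<le> s" using pos by simp
    have "?m - v = (1 - s / (s + t)) *\<^sub>R (u - v)"
      by (simp add: algebra_simps)
    also have "1 - s / (s + t) = t / (s + t)" using pos by (simp add: field_simps)
    finally have "dist ?m v = t / (s + t) * dist u v"
      using assms by (simp add: dist_norm)
    also have "\<dots> \<le> t / (s + t) * (s + t)"
      using assms by (intro mult_left_mono) auto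
    finally show "dist ?m v \<le> t" using pos by simp
  qed
qed

text \<open>The first lift misses its target, a point of the segment from \<open>f x\<close> to \<open>y\<close>, by up to \<open>K\<close>.
  The second lift therefore has to cover the distance \<open>t + K\<close> and not just \<open>t\<close>; its own error is
  again \<open>K\<close>, so errors do not accumulate.\<close>

lemma lifts_chain:
  assumes eq: "equivalent_norm \<nu>" and f: "f \<in> Z \<rightarrow> c0" and "s \<ge> 0" "t \<ge> 0"
    and s: "lifts \<nu> Z c0 f K \<rho> s" and t: "lifts \<nu> Z c0 f K \<sigma> (t + K)"
  shows "lifts \<nu> Z c0 f K (\<rho> + \<sigma>) (s + t)"
  unfolding lifts_def
proof (intro ballI impI)
  fix x y assume x: "x \<in> Z" and y: "y \<in> c0" and xy: "dist (f x) y \<le> s + t"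
  have "f x \<in> c0" using f x by blast
  then obtain m where m: "m \<in> c0" "dist (f x) m \<le> s" "dist m y \<le> t"
    using c0_segment_point[OF _ y xy \<open>s \<ge> 0\<close> \<open>t \<ge> 0\<close>] by blast
  obtain z where z: "z \<in> Z" "\<nu> (z - x) \<le> \<rho>" "dist (f z) m \<le> K"
    using liftsE[OF s x m(1,2)] by blast
  have "dist (f z) y \<le> t + K" using dist_triangle[of "f z" y m] m z by linarith
  then obtain w where w: "w \<in> Z" "\<nu> (w - z) \<le> \<sigma>" "dist (f w) y \<le> K"
    using liftsE[OF t z(1) y] by blast
  have "\<nu> (w - x) \<le> \<rho> + \<sigma>"
    using equivalent_norm_diff_triangle[OF eq, of w x z] w z by linarith
  thus "\<exists>z\<in>Z. \<nu> (z - x) \<le> \<rho> + \<sigma> \<and> dist (f z) y \<le> K" using w by blast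
qed

text \<open>Co-coarse continuity is only used at the scale \<open>1 + K\<close>: such a lift makes up for the error \<open>K\<close>
  of the previous one and still advances by \<open>1\<close>, so the displacement grows linearly.\<close>

lemma co_coarsely_continuous_lifting_slope:
  assumes eq: "equivalent_norm \<nu>" and f: "f \<in> Z \<rightarrow> c0" and "K \<ge> 0"
    and co: "co_coarsely_continuous K Z c0 f"
  obtains a where "a > 0" "lifting_slope \<nu> Z c0 f K a"
proof -
  obtain C where C: "C > 0" "\<And>x. \<nu> x \<le> C * norm x"
    using eq unfolding equivalent_norm_def by blast
  have "\<exists>\<delta>>0. \<forall>x\<in>Z. cball (f x) (1 + K) \<inter> c0 \<subseteq> enlargement c0 (f ` (cball x \<delta> \<inter> Z)) K"
    using co \<open>K \<ge> 0\<close> unfolding co_coarsely_continuous_def by simp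
  then obtain \<delta> where "\<delta> > 0"
    and \<delta>: "\<And>x. x \<in> Z \<Longrightarrow>
      cball (f x) (1 + K) \<inter> c0 \<subseteq> enlargement c0 (f ` (cball x \<delta> \<inter> Z)) K" by blast
  define \<rho> where "\<rho> = C * \<delta>"
  have "\<rho> > 0" unfolding \<rho>_def using C \<open>\<delta> > 0\<close> by simp
  have one: "lifts \<nu> Z c0 f K \<rho> (1 + K)"
    unfolding lifts_def
  proof (intro ballI impI)
    fix x y assume x: "x \<in> Z" and "y \<in> c0" "dist (f x) y \<le> 1 + K"
    hence "y \<in> enlargement c0 (f ` (cball x \<delta> \<inter> Z)) K" using \<delta>[OF x] by auto
    then obtain z where z: "z \<in> Z" "dist x z \<le> \<delta>" "dist y (f z) \<le> K"
      unfolding enlargement_def by auto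
    have "\<nu> (z - x) \<le> C * norm (z - x)" by (rule C)
    also have "\<dots> \<le> \<rho>" unfolding \<rho>_def using z(2) C(1)
      by (simp add: dist_norm norm_minus_commute)
    finally show "\<exists>z\<in>Z. \<nu> (z - x) \<le> \<rho> \<and> dist (f z) y \<le> K"
      using z by (auto simp: dist_commute)
  qed
  have nat: "lifts \<nu> Z c0 f K (\<rho> * Suc n) (Suc n)" for n
  proof (induction n)
    case 0
    show ?case using lifts_mono[OF one] \<open>K \<ge> 0\<close> by simp
  next
    case (Suc n)
    have "lifts \<nu> Z c0 f K (\<rho> * Suc n + \<rho>) (Suc n + 1)"
      using lifts_chain[OF eq f _ _ Suc one] by simp
    thus ?case by (simp add: algebra_simps)
  qed
  \<comment> \<open>The factor \<open>2\<close> pays for rounding \<open>s\<close> up to an integer.\<close>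
  have "lifts \<nu> Z c0 f K (2 * \<rho> * s) s" if "s \<ge> 1" for s
  proof -
    have le: "s \<le> Suc (nat \<lfloor>s\<rfloor>)" "Suc (nat \<lfloor>s\<rfloor>) \<le> 2 * s" using that by linarith+
    have "\<rho> * Suc (nat \<lfloor>s\<rfloor>) \<le> \<rho> * (2 * s)"
      using \<open>\<rho> > 0\<close> le(2) by (intro mult_left_mono) auto
    thus ?thesis using lifts_mono[OF nat _ le(1)] by (simp add: mult_ac)
  qed
  hence "lifting_slope \<nu> Z c0 f K (2 * \<rho>)"
    unfolding lifting_slope_def eventually_at_top_linorder by blast
  thus ?thesis using that[of "2 * \<rho>"] \<open>\<rho> > 0\<close> by simp
qed

section \<open>The slope is bounded below but can always be shrunk\<close>

text \<open>The scale \<open>s = 1\<close> of the Lipschitz condition suffices: smaller distances count as \<open>1\<close>.\<close>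

lemma lipschitz_for_large_distances_bound:
  assumes "lipschitz_for_large_distances Z N f"
  obtains L where "L > 0"
    "\<And>x z. x \<in> Z \<Longrightarrow> z \<in> Z \<Longrightarrow> dist (f x) (f z) \<le> L * max 1 (dist x z)"
proof -
  obtain L where "L > 0" and
    L: "\<And>r x. r \<ge> 1 \<Longrightarrow> x \<in> Z \<Longrightarrow> f ` (cball x r \<inter> Z) \<subseteq> cball (f x) (L * r) \<inter> N"
    using assms zero_less_one unfolding lipschitz_for_large_distances_def by meson
  have "dist (f x) (f z) \<le> L * max 1 (dist x z)" if "x \<in> Z" "z \<in> Z" for x z
    using L[of "max 1 (dist x z)" x] that by (auto simp: image_subset_iff)
  thus ?thesis using that \<open>L > 0\<close> by blast
qed

text \<open>For large \<open>s\<close>, a lift of the point \<open>f x + s e\<^sub>0\<close> has an image at distance at least \<open>s - K \<ge> s/2\<close> from \<open>f x\<close>,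
  which costs a displacement of at least \<open>s / (2 L)\<close>.\<close>

lemma lifting_slope_lower_bound:
  assumes "c > 0" and c: "\<And>x. c * norm x \<le> \<nu> x"
    and "Z \<noteq> {}" and f: "f \<in> Z \<rightarrow> c0" and "L > 0"
    and L: "\<And>x z. x \<in> Z \<Longrightarrow> z \<in> Z \<Longrightarrow> dist (f x) (f z) \<le> L * max 1 (dist x z)"
    and slope: "lifting_slope \<nu> Z c0 f K a"
  shows "c / (2 * L) \<le> a"
proof -
  have "\<forall>\<^sub>F s in at_top. lifts \<nu> Z c0 f K (a * s) s \<and> s > L + K \<and> s \<ge> 2 * K \<and> s > 0"
    using slope unfolding lifting_slope_def
    by (intro eventually_conj eventually_gt_at_top eventually_ge_at_top)
  then obtain s where s: "lifts \<nu> Z c0 f K (a * s) s" "s > L + K" "s \<ge> 2 * K" "s > 0"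
    using eventually_happens'[OF trivial_limit_at_top_linorder] by blast
  obtain x where x: "x \<in> Z" using \<open>Z \<noteq> {}\<close> by blast
  let ?y = "f x + s *\<^sub>R unit_seq 0"
  have norm1: "norm (unit_seq 0) = 1"
  proof (rule antisym)
    show "norm (unit_seq 0) \<le> 1" by (rule norm_bound) (simp add: apply_unit_seq)
    show "1 \<le> norm (unit_seq 0)" using norm_bounded[of "unit_seq 0" 0] by (simp add: apply_unit_seq)
  qed
  have y: "?y \<in> c0" "dist (f x) ?y = s"
    using f x s(4) by (auto intro!: c0_add c0_scaleR unit_seq_in_c0 simp: dist_norm norm1)
  obtain z where z: "z \<in> Z" "\<nu> (z - x) \<le> a * s" "dist (f z) ?y \<le> K"
    using liftsE[OF s(1) x y(1)] y(2) by auto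
  have "s - K \<le> dist (f x) (f z)" using dist_triangle[of "f x" ?y "f z"] y z by linarith
  hence sK: "s - K \<le> L * max 1 (dist x z)" using L[OF x z(1)] by linarith
  \<comment> \<open>Since \<open>s > L + K\<close>, the displacement is in the range where the Lipschitz bound is linear.\<close>
  hence "\<not> max 1 (dist x z) = 1" using s(2) by auto
  hence "s - K \<le> L * dist x z" using sK by (simp add: max_def split: if_splits)
  hence "s / 2 \<le> L * dist x z" using s(3) by linarith
  hence "c * (s / 2) \<le> L * (c * norm (z - x))"
    using \<open>c > 0\<close> mult_left_mono[of "s / 2" "L * dist x z" c]
    by (simp add: dist_norm norm_minus_commute mult_ac)
  also have "\<dots> \<le> L * (a * s)"
    using c[of "z - x"] z(2) \<open>L > 0\<close> by (intro mult_left_mono) auto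
  finally have "c / 2 * s \<le> (L * a) * s" by (simp add: mult_ac)
  hence "c / 2 \<le> L * a" using s(4) by simp
  thus ?thesis using \<open>L > 0\<close> by (simp add: field_simps)
qed

text \<open>The factor \<open>\<theta>\<close> depends on the slope only through the upper bound \<open>A\<close>, which is what allows the
  step to be iterated. Of three legs of length \<open>a s\<close>, property (beta) saves \<open>2 \<delta> a s\<close> on the first
  two, a proportion \<open>2 \<delta> / 3\<close> of the total. Claiming only \<open>\<delta> / 2\<close>, that is
  \<open>\<theta> = 1 - \<delta> / 2\<close>, leaves room for the additive errors at large scales.\<close>

lemma lifting_slope_shrink:
  assumes eq: "equivalent_norm \<nu>" and beta: "property_beta \<nu>"
    and "c > 0" and c: "\<And>x. c * norm x \<le> \<nu> x"
    and f: "f \<in> Z \<rightarrow> c0" and "L > 0" and "K \<ge> 0" and "A > 0"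
    and L: "\<And>x z. x \<in> Z \<Longrightarrow> z \<in> Z \<Longrightarrow> dist (f x) (f z) \<le> L * max 1 (dist x z)"
  obtains \<theta> where "0 < \<theta>" "\<theta> < 1"
    "\<And>a. \<lbrakk>0 < a; a \<le> A; lifting_slope \<nu> Z c0 f K a\<rbrakk> \<Longrightarrow> lifting_slope \<nu> Z c0 f K (\<theta> * a)"
proof -
  \<comment> \<open>At large scales, tips whose images are at distance \<open>s / 2\<close> or more are \<open>c s / (2 L)\<close>-separated for \<open>\<nu>\<close>, and the
    radius of the fork is at most \<open>A s\<close>; \<open>\<epsilon>\<close> is the quotient.\<close>
  define \<epsilon> where "\<epsilon> = c / (2 * L * A)"
  have "\<epsilon> > 0" unfolding \<epsilon>_def using \<open>c > 0\<close> \<open>L > 0\<close> \<open>A > 0\<close> by simp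
  obtain \<delta> where \<delta>: "0 < \<delta>" "\<delta> < 1" and fork:
    "\<And>\<rho> x z w. \<lbrakk>\<rho> > 0; \<nu> (x - z) \<le> \<rho>; \<And>i::nat. \<nu> (w i - z) \<le> \<rho>;
        \<And>i j. i \<noteq> j \<Longrightarrow> \<nu> (w i - w j) \<ge> \<epsilon> * \<rho>\<rbrakk> \<Longrightarrow> \<exists>i. \<nu> (x - w i) \<le> 2 * (1 - \<delta>) * \<rho>"
    using property_beta_fork[OF eq beta \<open>\<epsilon> > 0\<close>] by metis
  show ?thesis
  proof (rule that)
    show "0 < 1 - \<delta> / 2" "1 - \<delta> / 2 < 1" using \<delta> by auto
    fix a assume a: "0 < a" "a \<le> A" and slope: "lifting_slope \<nu> Z c0 f K a"
    obtain R where R: "\<And>s. s \<ge> R \<Longrightarrow> lifts \<nu> Z c0 f K (a * s) s"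
      using slope unfolding lifting_slope_def eventually_at_top_linorder by blast
    have lift: "lifts \<nu> Z c0 f K ((1 - \<delta> / 2) * a * r) r"
      if r: "r \<ge> 3 * R" "r > 3 * (L + 2 * K)" "r \<ge> 15 * K + 3" "r \<ge> 18 * (K + 1) / \<delta>" "r > 0" for r
    proof -
      \<comment> \<open>Each leg has length at most \<open>r / 3 + 1\<close>, and starts at most \<open>K\<close> away from its intended origin.\<close>
      define s where "s = r / 3 + K + 1"
      have s: "lifts \<nu> Z c0 f K (a * s) s"
        using R r(1) \<open>K \<ge> 0\<close> unfolding s_def by (intro R) linarith
      have "s > 0" using \<open>K \<ge> 0\<close> r(5) unfolding s_def by linarith
      have half: "s / 2 \<le> r / 3 - 2 * K" using r(3) unfolding s_def by (simp add: field_simps)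
      have "18 * (K + 1) \<le> r * \<delta>" using r(4) \<delta>(1) by (simp add: field_simps)
      hence sum: "(3 - 2 * \<delta>) * s \<le> (1 - \<delta> / 2) * r"
      proof -
        have "(3 - 2 * \<delta>) * s \<le> r - 2 / 3 * (r * \<delta>) + 3 * (K + 1)"
          using \<open>K \<ge> 0\<close> \<delta>(1) unfolding s_def by (simp add: algebra_simps)
        thus ?thesis using \<open>18 * (K + 1) \<le> r * \<delta>\<close> by (simp add: algebra_simps)
      qed
      show ?thesis unfolding lifts_def
      proof (intro ballI impI)
        fix x y assume x: "x \<in> Z" and y: "y \<in> c0" and xy: "dist (f x) y \<le> r"
        have fx: "f x \<in> c0" using f x by blast
        define u where "u = y - f x"
        have u: "u \<in> c0" "norm u \<le> r"
          using c0_diff[OF y fx] xy unfolding u_def by (auto simp: dist_norm norm_minus_commute)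
        obtain p :: "nat \<Rightarrow> (nat \<Rightarrow>\<^sub>C real)" where p: "\<And>n. p n \<in> c0"
          "\<And>n. norm (p n - (1/3) *\<^sub>R u) \<le> r / 3 + 1"
          "\<And>n. norm (u - p n) \<le> r / 3 + 1" "\<And>n k. n \<noteq> k \<Longrightarrow> norm (p n - p k) \<ge> r / 3"
          using c0_fork[OF u] by metis
        let ?m = "f x + (1/3) *\<^sub>R u" and ?q = "\<lambda>n. f x + p n"
        have m: "?m \<in> c0" by (intro c0_add c0_scaleR fx u)
        have q: "?q n \<in> c0" for n by (intro c0_add fx p)
        have "dist (f x) ?m \<le> s"
          using u(2) \<open>K \<ge> 0\<close> unfolding s_def by (simp add: dist_norm)
        then obtain z where z: "z \<in> Z" "\<nu> (z - x) \<le> a * s" "dist (f z) ?m \<le> K"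
          using liftsE[OF s x m] by blast
        have "\<exists>w\<in>Z. \<nu> (w - z) \<le> a * s \<and> dist (f w) (?q n) \<le> K" for n
        proof -
          have "dist ?m (?q n) \<le> r / 3 + 1"
            using p(2)[of n] by (simp add: dist_norm norm_minus_commute)
          hence "dist (f z) (?q n) \<le> s"
            using dist_triangle[of "f z" "?q n" ?m] z(3) unfolding s_def by linarith
          thus ?thesis using liftsE[OF s z(1) q] by blast
        qed
        then obtain w where w: "\<And>n. w n \<in> Z" "\<And>n. \<nu> (w n - z) \<le> a * s"
          "\<And>n. dist (f (w n)) (?q n) \<le> K" by metis
        have sep: "\<nu> (w i - w j) \<ge> \<epsilon> * (a * s)" if "i \<noteq> j" for i j
        proof -
          have "r / 3 \<le> dist (?q i) (?q j)" using p(4)[OF that] by (simp add: dist_norm)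
          also have "\<dots> \<le> dist (f (w i)) (f (w j)) + 2 * K"
            using dist_triangle[of "?q i" "?q j" "f (w i)"] dist_triangle[of "f (w i)" "?q j" "f (w j)"]
              w(3)[of i] w(3)[of j] by (simp add: dist_commute)
          finally have big: "r / 3 - 2 * K \<le> L * max 1 (dist (w i) (w j))"
            using L[OF w(1)[of i] w(1)[of j]] by linarith
          hence "\<not> max 1 (dist (w i) (w j)) = 1" using r(2) by auto
          hence "r / 3 - 2 * K \<le> L * dist (w i) (w j)"
            using big by (simp add: max_def split: if_splits)
          hence sd: "s / 2 \<le> L * norm (w i - w j)" using half by (simp add: dist_norm)
          have "\<epsilon> * (a * s) \<le> \<epsilon> * (A * s)"
            using a \<open>\<epsilon> > 0\<close> \<open>s > 0\<close> by simp
          also have "\<dots> = c / L * (s / 2)" unfolding \<epsilon>_def using \<open>A > 0\<close> by simp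
          also have "\<dots> \<le> c / L * (L * norm (w i - w j))"
            using sd \<open>c > 0\<close> \<open>L > 0\<close> by (intro mult_left_mono) auto
          also have "\<dots> = c * norm (w i - w j)" using \<open>L > 0\<close> by simp
          also have "\<dots> \<le> \<nu> (w i - w j)" by (rule c)
          finally show ?thesis .
        qed
        have "\<nu> (x - z) \<le> a * s" using z(2) equivalent_norm_minus_commute[OF eq] by metis
        then obtain i where i: "\<nu> (x - w i) \<le> 2 * (1 - \<delta>) * (a * s)"
          using fork[of "a * s" x z w] a \<open>s > 0\<close> w(2) sep by auto
        have "dist (?q i) y \<le> r / 3 + 1"
          using p(3)[of i] unfolding u_def by (simp add: dist_norm norm_minus_commute algebra_simps)
        hence "dist (f (w i)) y \<le> s"
          using dist_triangle[of "f (w i)" y "?q i"] w(3)[of i] unfolding s_def by linarith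
        then obtain v where v: "v \<in> Z" "\<nu> (v - w i) \<le> a * s" "dist (f v) y \<le> K"
          using liftsE[OF s w(1) y] by blast
        have "\<nu> (v - x) \<le> a * s + 2 * (1 - \<delta>) * (a * s)"
          using equivalent_norm_diff_triangle[OF eq, of v x "w i"] v(2) i
            equivalent_norm_minus_commute[OF eq, of "w i" x] by linarith
        also have "\<dots> = a * ((3 - 2 * \<delta>) * s)" by (simp add: algebra_simps)
        also have "\<dots> \<le> a * ((1 - \<delta> / 2) * r)" using sum a by (intro mult_left_mono) auto
        finally show "\<exists>z\<in>Z. \<nu> (z - x) \<le> (1 - \<delta> / 2) * a * r \<and> dist (f z) y \<le> K"
          using v by (auto simp: mult_ac)
      qed
    qed
    have "\<forall>\<^sub>F r in at_top. r \<ge> 3 * R \<and> r > 3 * (L + 2 * K) \<and> r \<ge> 15 * K + 3 \<and>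
        r \<ge> 18 * (K + 1) / \<delta> \<and> r > 0"
      by (intro eventually_conj eventually_gt_at_top eventually_ge_at_top)
    thus "lifting_slope \<nu> Z c0 f K ((1 - \<delta> / 2) * a)"
      unfolding lifting_slope_def by eventually_elim (use lift in blast)
  qed
qed

theorem theorem4p9:
  assumes "\<exists>\<nu> :: 'a::banach \<Rightarrow> real. equivalent_norm \<nu> \<and> property_beta \<nu>"
  shows "\<not> (\<exists>(Z :: 'a set) (f :: 'a \<Rightarrow> (nat \<Rightarrow>\<^sub>C real)).
            Z \<noteq> {} \<and> coarse_quotient_map Z c0 f \<and> lipschitz_for_large_distances Z c0 f)"
proof
  assume "\<exists>(Z :: 'a set) (f :: 'a \<Rightarrow> (nat \<Rightarrow>\<^sub>C real)).
            Z \<noteq> {} \<and> coarse_quotient_map Z c0 f \<and> lipschitz_for_large_distances Z c0 f"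
  then obtain Z :: "'a set" and f :: "'a \<Rightarrow> (nat \<Rightarrow>\<^sub>C real)" and K where
    "Z \<noteq> {}" and f: "f \<in> Z \<rightarrow> c0" and "K \<ge> 0" and co: "co_coarsely_continuous K Z c0 f"
    and lip: "lipschitz_for_large_distances Z c0 f"
    unfolding coarse_quotient_map_def by blast
  obtain \<nu> :: "'a \<Rightarrow> real" where eq: "equivalent_norm \<nu>" and beta: "property_beta \<nu>"
    using assms by blast
  obtain c where "c > 0" and c: "\<And>x. c * norm x \<le> \<nu> x"
    using eq unfolding equivalent_norm_def by blast
  obtain L where "L > 0" and
    L: "\<And>x z. x \<in> Z \<Longrightarrow> z \<in> Z \<Longrightarrow> dist (f x) (f z) \<le> L * max 1 (dist x z)"
    using lipschitz_for_large_distances_bound[OF lip] by blast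
  obtain A where "A > 0" and A: "lifting_slope \<nu> Z c0 f K A"
    using co_coarsely_continuous_lifting_slope[OF eq f \<open>K \<ge> 0\<close> co] by blast
  obtain \<theta> where \<theta>: "0 < \<theta>" "\<theta> < 1" and shrink:
    "\<And>a. \<lbrakk>0 < a; a \<le> A; lifting_slope \<nu> Z c0 f K a\<rbrakk> \<Longrightarrow> lifting_slope \<nu> Z c0 f K (\<theta> * a)"
    using lifting_slope_shrink[OF eq beta \<open>c > 0\<close> c f \<open>L > 0\<close> \<open>K \<ge> 0\<close> \<open>A > 0\<close> L] by metis
  have slope: "lifting_slope \<nu> Z c0 f K (\<theta> ^ n * A)" for n
  proof (induction n)
    case (Suc n)
    have "\<theta> ^ n * A \<le> A" using \<theta> \<open>A > 0\<close> by (simp add: power_le_one)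
    thus ?case using shrink[OF _ _ Suc] \<theta> \<open>A > 0\<close> by (simp add: mult_ac)
  qed (use A in simp)
  have "c / (2 * L) \<le> \<theta> ^ n * A" for n
    by (rule lifting_slope_lower_bound[OF \<open>c > 0\<close> c \<open>Z \<noteq> {}\<close> f \<open>L > 0\<close> L slope])
  moreover have "(\<lambda>n. \<theta> ^ n * A) \<longlonglongrightarrow> 0"
    using \<theta> by (intro tendsto_mult_left_zero LIMSEQ_realpow_zero) auto
  ultimately have "c / (2 * L) \<le> 0" by (intro LIMSEQ_le_const) auto
  thus False using \<open>c > 0\<close> \<open>L > 0\<close> by (simp add: divide_le_0_iff)
qed

end
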